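(* Let $F$ be a Banach space, let $X:\mathbb{R}\to L(F)$ be continuous and $1$-periodic, let $g(\cdot)$ be its associated fundamental solution, $g=g(1)$, and let $\phi^t$ be the associated skew-product flow on $S^1\times F$. Then \[ \mathcal{R}(\phi^t) = S^1 \times_g \mathcal{R}(g), \] where $\mathcal{R}(\phi^t)$ is the recurrent set of the continuous-time flow $\phi^t$ and $\mathcal{R}(g)$ is the recurrent set of the discrete-time flow $n\mapsto g^n$ on $F$.
   Context: Setting. $F$ is a (real or complex) Banach space with norm $|\cdot|$, $L(F)$ is the Banach space of bounded linear operators on $F$ with the operator norm, and $X:\mathbb{R}\to L(F)$ is a continuous map with $X(t+1)=X(t)$ for all $t$. The associated fundamental solution is the differentiable curve $t\mapsto g(t)\in L(F)$, $t\in\mathbb{R}$, with $g'(t)=X(t)g(t)$, $g(0)=I$; it exists uniquely on $\mathbb{R}$ and each $g(t)$ is invertible in $L(F)$. Put $g=g(1)$; then $g(t+n)=g(t)g^n$ for all $t\in\mathbb{R}$ and all natural $n$. The discrete-time flow generated by $g$ is $n\mapsto g^n$, $n\in\mathbb{Z}$, on $F$. Let $S^1=\mathbb{R}/\mathbb{Z}$ and $\overline{s}=s+\mathbb{Z}$. The associated skew-product flow on $S^1\times F$ is the (well-defined, continuous) flow $\phi^t(\overline{s},x)=(\overline{s+t},\,g(t+s)g(s)^{-1}x)$, $t\in\mathbb{R}$. $F$ carries the metric $d(x,y)=|x-y|$ and $S^1\times F$ carries the metric $\overline{d}((\overline{s},x),(\overline{r},y))=\min\{|s-r|,1-|s-r|\}+d(x,y)$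 for $s,r\in[0,1)$, $x,y\in F$. For a subset $E\subset F$ that is $g$-invariant (i.e. $g^n(E)=E$ for all $n\in\mathbb{Z}$), define $S^1\times_g E=\bigcup_{s\in\mathbb{R}}\{\overline{s}\}\times g(s)E\subset S^1\times F$. For a flow $\sigma^t$ ($t\in\mathbb{R}$ or $t\in\mathbb{Z}$) on a metric space $U$, the $\omega$-limit set of $x\in U$ is the set of $y\in U$ such that there is a sequence of times $t_k\to\infty$ with $\sigma^{t_k}(x)\to y$. A point is recurrent if it belongs to its own $\omega$-limit set; the recurrent set $\mathcal{R}(\sigma^t)$ is the set of all recurrent points (it is invariant under the flow). *)

theory Defs
  imports "HOL-Analysis.Analysis"
begin

section \<open>The circle and the metric on the product with a metric space\<close>

quotient_type circle = real / "\<lambda>s r. s - r \<in> \<int>"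
  morphisms rep_circle circle_of
proof (rule equivpI)
  show "reflp (\<lambda>s r::real. s - r \<in> \<int>)"
    by (auto intro: reflpI)
  show "symp (\<lambda>s r::real. s - r \<in> \<int>)"
    by (auto intro!: sympI) (metis Ints_minus minus_diff_eq)
  show "transp (\<lambda>s r::real. s - r \<in> \<int>)"
    by (auto intro!: transpI) (metis Ints_add diff_add_cancel add_diff_eq)
qed

text \<open>The representative in \<open>[0,1)\<close> of a point of the circle.\<close>

lift_definition circle_frac :: "circle \<Rightarrow> real" is frac
  by (metis Ints_cases add.commute diff_add_cancel frac_add_of_int_right)

lemma circle_frac_circle_of [simp]: "circle_frac (circle_of s) = frac s"
  by transfer simp

lemma circle_of_circle_frac [simp]: "circle_of (circle_frac c) = c"
  by transfer (simp add: frac_def)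

lemma circle_of_eq_iff: "circle_of s = circle_of r \<longleftrightarrow> s - r \<in> \<int>"
  by transfer simp

definition circle_prod_dist :: "circle \<times> 'a::metric_space \<Rightarrow> circle \<times> 'a \<Rightarrow> real" where
  "circle_prod_dist = (\<lambda>(c, x) (c', y).
     min \<bar>circle_frac c - circle_frac c'\<bar> (1 - \<bar>circle_frac c - circle_frac c'\<bar>) + dist x y)"

lemma circle_frac_bounds: "0 \<le> circle_frac c" "circle_frac c < 1"
  by (transfer, simp add: frac_lt_1)+

lemma circle_frac_inject: "circle_frac c = circle_frac c' \<longleftrightarrow> c = c'"
  by (metis circle_of_circle_frac)

lemma Metric_space_circle_prod_dist:
  "Metric_space UNIV (circle_prod_dist :: circle \<times> 'a::metric_space \<Rightarrow> _)"
proof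
  fix p q r :: "circle \<times> 'a"
  obtain c x where p: "p = (c, x)" by (cases p)
  obtain d y where q: "q = (d, y)" by (cases q)
  obtain e z where r: "r = (e, z)" by (cases r)
  note b = circle_frac_bounds[of c] circle_frac_bounds[of d] circle_frac_bounds[of e]
  show "0 \<le> circle_prod_dist p q"
    using b zero_le_dist[of x y] unfolding circle_prod_dist_def p q prod.case by linarith
  show "circle_prod_dist p q = circle_prod_dist q p"
    by (simp add: circle_prod_dist_def p q dist_commute abs_minus_commute)
  show "circle_prod_dist p q = 0 \<longleftrightarrow> p = q"
  proof
    assume "circle_prod_dist p q = 0"
    then have "circle_frac c = circle_frac d \<and> dist x y = 0"
      using b zero_le_dist[of x y] unfolding circle_prod_dist_def p q prod.case
      by linarith
    then show "p = q" by (simp add: p q circle_frac_inject)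
  qed (simp add: circle_prod_dist_def p q)
  show "circle_prod_dist p r \<le> circle_prod_dist p q + circle_prod_dist q r"
    using b dist_triangle[of x z y] unfolding circle_prod_dist_def p q r prod.case
    by linarith
qed


section \<open>Recurrence for continuous-time and discrete-time flows\<close>

text \<open>The metric \<open>d\<close> on the phase space is an explicit argument; the time domain \<open>'t\<close> is
  \<open>real\<close> or \<open>int\<close>.\<close>

definition omega_limit :: "('u \<Rightarrow> 'u \<Rightarrow> real) \<Rightarrow> ('t::linorder \<Rightarrow> 'u \<Rightarrow> 'u) \<Rightarrow> 'u \<Rightarrow> 'u set" where
  "omega_limit d \<sigma> x = {y. \<exists>t :: nat \<Rightarrow> 't. filterlim t at_top sequentially \<and>
     limitin (Metric_space.mtopology UNIV d) (\<lambda>k. \<sigma> (t k) x) y sequentially}"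

definition recurrent_set :: "('u \<Rightarrow> 'u \<Rightarrow> real) \<Rightarrow> ('t::linorder \<Rightarrow> 'u \<Rightarrow> 'u) \<Rightarrow> 'u set" where
  "recurrent_set d \<sigma> = {x. x \<in> omega_limit d \<sigma> x}"


section \<open>Fundamental solutions and the associated flows\<close>

definition fundamental_solution ::
  "(real \<Rightarrow> 'a::banach \<Rightarrow>\<^sub>L 'a) \<Rightarrow> (real \<Rightarrow> 'a \<Rightarrow>\<^sub>L 'a) \<Rightarrow> bool" where
  "fundamental_solution X g \<longleftrightarrow>
     g 0 = id_blinfun \<and> (\<forall>t. (g has_vector_derivative X t o\<^sub>L g t) (at t))"

text \<open>Inverses of bounded operators are taken as inverses of functions. For a fundamental solution
  of a continuous 1-periodic \<open>X\<close> every \<open>g t\<close> is bijective (see below), so these are the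
  actual inverses.\<close>

definition discrete_flow :: "('a::banach \<Rightarrow>\<^sub>L 'a) \<Rightarrow> int \<Rightarrow> 'a \<Rightarrow> 'a" where
  "discrete_flow T n =
     (if 0 \<le> n then blinfun_apply T ^^ nat n else inv (blinfun_apply T) ^^ nat (- n))"

text \<open>The flow is defined through the representative in \<open>[0,1)\<close>; lemma
  \<open>skew_product_flow_circle_of\<close> below shows that for the fundamental solution of a periodic
  equation any other representative gives the same point.\<close>

definition skew_product_flow ::
  "(real \<Rightarrow> 'a::banach \<Rightarrow>\<^sub>L 'a) \<Rightarrow> real \<Rightarrow> circle \<times> 'a \<Rightarrow> circle \<times> 'a" where
  "skew_product_flow g t = (\<lambda>(c, x). let s = circle_frac c in
     (circle_of (s + t), blinfun_apply (g (t + s)) (inv (blinfun_apply (g s)) x)))"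

definition circle_twisted_prod ::
  "(real \<Rightarrow> 'a::banach \<Rightarrow>\<^sub>L 'a) \<Rightarrow> 'a set \<Rightarrow> (circle \<times> 'a) set" where
  "circle_twisted_prod g E = (\<Union>s. {circle_of s} \<times> blinfun_apply (g s) ` E)"


section \<open>Well-definedness of the skew-product flow\<close>

lemma periodic_bounded:
  fixes X :: "real \<Rightarrow> 'b::real_normed_vector"
  assumes "continuous_on UNIV X" and per: "\<And>t. X (t + 1) = X t"
  obtains K where "0 \<le> K" "\<And>t. norm (X t) \<le> K"
proof -
  have int: "X (t + of_int n) = X t" for t n
  proof (induction n rule: int_induct[where k = 0])
    case (step1 i)
    then show ?case using per[of "t + of_int i"] by (simp add: add.assoc)
  next
    case (step2 i)
    then show ?case using per[of "t + of_int (i - 1)"] by (simp add: add.assoc)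
  qed simp
  have "compact (X ` {0..1})"
    using assms(1) by (intro compact_continuous_image) (auto intro: continuous_on_subset)
  then obtain K where K: "\<And>t. t \<in> {0..1} \<Longrightarrow> norm (X t) \<le> K"
    by (metis bounded_iff compact_imp_bounded imageI)
  have "norm (X t) \<le> K" for t
  proof -
    have "X t = X (frac t)"
      using int[of "frac t" "\<lfloor>t\<rfloor>"] by (simp add: frac_def)
    then show ?thesis using K[of "frac t"] by (simp add: frac_lt_1 less_imp_le)
  qed
  moreover have "0 \<le> K" using order_trans[OF norm_ge_zero K[of 0]] by simp
  ultimately show thesis by (rule that[rotated])
qed

lemma linear_ode_local_bound:
  fixes h :: "real \<Rightarrow> 'a::banach"
  assumes K: "0 \<le> K" "\<And>t. norm (X t :: 'a \<Rightarrow>\<^sub>L 'a) \<le> K"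
    and h: "\<And>t. (h has_vector_derivative blinfun_apply (X t) (h t)) (at t)"
    and ts: "4 * (K * \<bar>t - s\<bar>) \<le> 1"
  shows "norm (h t - h s) \<le> norm (h s) / 3"
proof -
  let ?S = "closed_segment s t"
  have "continuous_on ?S (\<lambda>r. norm (h r))"
    by (intro continuous_on_norm continuous_at_imp_continuous_on ballI
        has_vector_derivative_continuous[OF h])
  then obtain m where m: "m \<in> ?S" "\<And>r. r \<in> ?S \<Longrightarrow> norm (h r) \<le> norm (h m)"
    using continuous_attains_sup[of ?S "\<lambda>r. norm (h r)"] by auto
  have bound: "norm (h r - h s) \<le> norm (h m) / 4" if r: "r \<in> ?S" for r
  proof -
    have "norm (h r - h s) \<le> (K * norm (h m)) * norm (r - s)"
    proof (rule differentiable_bound[where S = ?S and f' = "\<lambda>r u. u *\<^sub>R blinfun_apply (X r) (h r)"])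
      fix x assume x: "x \<in> ?S"
      show "(h has_derivative (\<lambda>u. u *\<^sub>R blinfun_apply (X x) (h x))) (at x within ?S)"
        using h[of x] unfolding has_vector_derivative_def by (rule has_derivative_at_withinI)
      have "norm (blinfun_apply (X x) (h x)) \<le> K * norm (h m)"
        by (rule order_trans[OF norm_blinfun]) (intro mult_mono K m x norm_ge_zero)
      then show "onorm (\<lambda>u. u *\<^sub>R blinfun_apply (X x) (h x)) \<le> K * norm (h m)"
        by (intro onorm_le) (simp add: mult.commute[of "\<bar>_\<bar>"] mult_right_mono)
    qed (use r in auto)
    also have "\<bar>r - s\<bar> \<le> \<bar>t - s\<bar>"
      using r by (auto simp: closed_segment_eq_real_ivl split: if_splits)
    then have "(K * norm (h m)) * norm (r - s) \<le> (K * norm (h m)) * \<bar>t - s\<bar>"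
      using K(1) by (intro mult_left_mono) auto
    also have "\<dots> = (K * \<bar>t - s\<bar>) * norm (h m)" by simp
    also have "\<dots> \<le> (1 / 4) * norm (h m)"
      using ts by (intro mult_right_mono) auto
    finally show ?thesis by simp
  qed
  have "norm (h m) \<le> norm (h s) + norm (h m) / 4"
    using bound[OF m(1)] norm_triangle_sub[of "h m" "h s"] by linarith
  then show ?thesis using bound[of t] by simp
qed

lemma real_local_propagation:
  fixes P :: "real \<Rightarrow> bool"
  assumes "0 < \<delta>" "P a" and step: "\<And>s t. P s \<Longrightarrow> \<bar>t - s\<bar> \<le> \<delta> \<Longrightarrow> P t"
  shows "P t"
proof -
  have "\<forall>t. \<bar>t - a\<bar> \<le> real n * \<delta> \<longrightarrow> P t" for n
  proof (induction n)
    case (Suc n)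
    show ?case
    proof (intro allI impI)
      fix t assume t: "\<bar>t - a\<bar> \<le> real (Suc n) * \<delta>"
      define s where "s = (if \<bar>t - a\<bar> \<le> \<delta> then a else t - sgn (t - a) * \<delta>)"
      have "\<bar>s - a\<bar> \<le> real n * \<delta>" "\<bar>t - s\<bar> \<le> \<delta>"
        using t \<open>0 < \<delta>\<close> by (auto simp: s_def sgn_if algebra_simps split: if_splits)
      then show "P t" using Suc step by blast
    qed
  qed (use assms in auto)
  moreover obtain n where "\<bar>t - a\<bar> / \<delta> \<le> real n" using real_arch_simple by blast
  ultimately show ?thesis using \<open>0 < \<delta>\<close> by (simp add: field_simps)
qed

context
  fixes X g :: "real \<Rightarrow> 'a::banach \<Rightarrow>\<^sub>L 'a"
  assumes cont: "continuous_on UNIV X" and per: "\<And>t. X (t + 1) = X t"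
    and fund: "fundamental_solution X g"
begin

lemma fundamental_solution_vector_derivative:
  "((\<lambda>t. blinfun_apply (g t) x) has_vector_derivative blinfun_apply (X t) (blinfun_apply (g t) x)) (at t)"
proof -
  have "(g has_vector_derivative X t o\<^sub>L g t) (at t)"
    using fund by (simp add: fundamental_solution_def)
  from bounded_linear.has_vector_derivative[OF blinfun.bounded_linear_left this]
  show ?thesis by simp
qed

lemma linear_ode_bound_step:
  obtains \<delta> where "0 < \<delta>"
    "\<And>h s t. (\<And>t. (h has_vector_derivative blinfun_apply (X t) (h t)) (at t)) \<Longrightarrow>
       \<bar>t - s\<bar> \<le> \<delta> \<Longrightarrow> norm (h t - h s :: 'a) \<le> norm (h s) / 3"
proof -
  obtain K where K: "0 \<le> K" "\<And>t. norm (X t) \<le> K"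
    using periodic_bounded[OF cont per] by blast
  show thesis
  proof (rule that[of "1 / (4 * (K + 1))"])
    fix h :: "real \<Rightarrow> 'a" and s t
    assume h: "\<And>t. (h has_vector_derivative blinfun_apply (X t) (h t)) (at t)"
      and "\<bar>t - s\<bar> \<le> 1 / (4 * (K + 1))"
    then have "4 * ((K + 1) * \<bar>t - s\<bar>) \<le> 1" using K(1) by (simp add: field_simps)
    moreover have "K * \<bar>t - s\<bar> \<le> (K + 1) * \<bar>t - s\<bar>" by (intro mult_right_mono) auto
    ultimately have "4 * (K * \<bar>t - s\<bar>) \<le> 1" by linarith
    from linear_ode_local_bound[OF K h this]
    show "norm (h t - h s) \<le> norm (h s) / 3" .
  qed (use K in simp)
qed

lemma linear_ode_unique_zero:
  fixes h :: "real \<Rightarrow> 'a"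
  assumes h: "\<And>t. (h has_vector_derivative blinfun_apply (X t) (h t)) (at t)" and "h a = 0"
  shows "h t = 0"
proof -
  obtain \<delta> where \<delta>: "0 < \<delta>"
    "\<And>s t. \<bar>t - s\<bar> \<le> \<delta> \<Longrightarrow> norm (h t - h s) \<le> norm (h s) / 3"
    using linear_ode_bound_step h by metis
  show ?thesis
    by (rule real_local_propagation[where P = "\<lambda>t. h t = 0" and \<delta> = \<delta> and a = a])
      (use \<delta> assms in force)+
qed

lemma fundamental_solution_bij: "bij (blinfun_apply (g t))"
proof -
  obtain \<delta> where \<delta>: "0 < \<delta>"
    "\<And>h s t. (\<And>t. (h has_vector_derivative blinfun_apply (X t) (h t)) (at t)) \<Longrightarrow>
       \<bar>t - s\<bar> \<le> \<delta> \<Longrightarrow> norm (h t - h s :: 'a) \<le> norm (h s) / 3"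
    using linear_ode_bound_step by blast
  show ?thesis
  proof (rule real_local_propagation[where P = "\<lambda>t. bij (blinfun_apply (g t))" and \<delta> = \<delta> and a = 0])
    show "bij (blinfun_apply (g 0))"
      using fund by (simp add: fundamental_solution_def id_blinfun.rep_eq bij_id[unfolded id_def])
    fix s t assume s: "bij (blinfun_apply (g s))" and ts: "\<bar>t - s\<bar> \<le> \<delta>"
    have est: "norm (blinfun_apply (g t) x - blinfun_apply (g s) x) \<le> norm (blinfun_apply (g s) x) / 3" for x
      using \<delta>(2)[OF fundamental_solution_vector_derivative ts] .
    show "bij (blinfun_apply (g t))"
    proof (rule bijI)
      show "inj (blinfun_apply (g t))"
      proof (rule injI)
        fix x y assume "blinfun_apply (g t) x = blinfun_apply (g t) y"
        then have "norm (blinfun_apply (g s) (x - y)) \<le> norm (blinfun_apply (g s) (x - y)) / 3"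
          using est[of "x - y"] by (simp add: blinfun.diff_right[of "g t"])
        then have "norm (blinfun_apply (g s) (x - y)) \<le> 0" by simp
        then have "blinfun_apply (g s) (x - y) = 0" by simp
        then show "x = y" using s by (simp add: blinfun.diff_right bij_def inj_eq)
      qed
      show "surj (blinfun_apply (g t))"
      proof -
        have "\<exists>x. blinfun_apply (g t) x = z" for z
        proof -
          let ?i = "inv (blinfun_apply (g s))"
          have gi: "blinfun_apply (g s) (?i y) = y" for y
            using s by (simp add: bij_is_surj surj_f_inv_f)
          define f where "f y = z - (blinfun_apply (g t) (?i y) - y)" for y
          have "\<exists>!y. f y = y"
          proof (rule banach_fix_type[of "1/3"])
            show "\<forall>x y. dist (f x) (f y) \<le> 1 / 3 * dist x y"
            proof (intro allI)
              fix x y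
              have "f x - f y = - (blinfun_apply (g t) (?i x - ?i y) - blinfun_apply (g s) (?i x - ?i y))"
                by (simp add: f_def blinfun.diff_right gi)
              then have "norm (f x - f y) = norm (blinfun_apply (g t) (?i x - ?i y) - blinfun_apply (g s) (?i x - ?i y))"
                by (simp only: norm_minus_cancel)
              with est[of "?i x - ?i y"] show "dist (f x) (f y) \<le> 1 / 3 * dist x y"
                by (simp add: dist_norm blinfun.diff_right gi)
            qed
          qed auto
          then obtain y where "f y = y" by blast
          then have "blinfun_apply (g t) (?i y) = z" by (simp add: f_def algebra_simps)
          then show ?thesis by blast
        qed
        then show ?thesis by (metis surjI)
      qed
    qed
  qed (rule \<delta>(1))
qed

lemma fundamental_solution_add_1: "g (t + 1) = g t o\<^sub>L g 1"
proof (rule blinfun_eqI)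
  fix x
  define h where "h t = blinfun_apply (g (t + 1)) x - blinfun_apply (g t) (blinfun_apply (g 1) x)" for t
  have "(h has_vector_derivative blinfun_apply (X t) (h t)) (at t)" for t
  proof -
    have "((\<lambda>t. blinfun_apply (g t) x) \<circ> (\<lambda>t. t + 1) has_vector_derivative
        1 *\<^sub>R blinfun_apply (X (t + 1)) (blinfun_apply (g (t + 1)) x)) (at t)"
      by (rule vector_diff_chain_at[OF _ fundamental_solution_vector_derivative])
        (auto intro!: derivative_eq_intros)
    from has_vector_derivative_diff[OF this fundamental_solution_vector_derivative[of "blinfun_apply (g 1) x"]]
    show ?thesis by (simp add: h_def[abs_def] o_def per blinfun.diff_right)
  qed
  moreover have "h 0 = 0" using fund by (simp add: h_def fundamental_solution_def)
  ultimately have "h t = 0" by (rule linear_ode_unique_zero)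
  then show "blinfun_apply (g (t + 1)) x = blinfun_apply (g t o\<^sub>L g 1) x" by (simp add: h_def)
qed

lemma skew_product_flow_circle_of:
  "skew_product_flow g t (circle_of s, x) =
     (circle_of (s + t), blinfun_apply (g (t + s)) (inv (blinfun_apply (g s)) x))"
proof -
  define c where "c s = blinfun_apply (g (t + s)) (inv (blinfun_apply (g s)) x)" for s
  have step: "c (s + 1) = c s" for s
  proof -
    have "blinfun_apply (g (s + 1)) = blinfun_apply (g s) \<circ> blinfun_apply (g 1)"
      by (simp add: fundamental_solution_add_1 fun_eq_iff)
    then have "inv (blinfun_apply (g (s + 1))) = inv (blinfun_apply (g 1)) \<circ> inv (blinfun_apply (g s))"
      by (simp add: o_inv_distrib fundamental_solution_bij)
    moreover have "blinfun_apply (g 1) (inv (blinfun_apply (g 1)) y) = y" for y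
      by (simp add: surj_f_inv_f bij_is_surj fundamental_solution_bij)
    ultimately show ?thesis
      using fundamental_solution_add_1[of "t + s"] by (simp add: c_def add.assoc)
  qed
  have "c (s + of_int n) = c s" for s n
  proof (induction n rule: int_induct[where k = 0])
    case (step1 i)
    then show ?case using step[of "s + of_int i"] by (simp add: add.assoc)
  next
    case (step2 i)
    then show ?case using step[of "s + of_int (i - 1)"] by (simp add: add.assoc)
  qed simp
  from this[of "frac s" "\<lfloor>s\<rfloor>"] have "c (frac s) = c s" by (simp add: frac_def)
  moreover have "circle_of (frac s + t) = circle_of (s + t)"
    by (simp add: circle_of_eq_iff frac_def)
  ultimately show ?thesis by (simp add: skew_product_flow_def Let_def c_def)
qed

end

end

theory Submission
  imports Defs
begin

text \<open>
  Every point of the phase space can be written as \<open>(circle_of s, g s x)\<close>, and along its orbit the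
  flow reads \<open>(circle_of (s + t), g (s + t) x)\<close>. The theorem therefore amounts to this: the point
  \<open>(circle_of s, g s x)\<close> is recurrent for the skew-product flow iff \<open>x\<close> is recurrent for the
  iterates of \<open>g 1\<close>. The link between both is the Floquet identity
  \<open>g (s + n) x = g s (g 1 ^ n x)\<close> for integers \<open>n\<close>.

  If \<open>g 1 ^ n\<^sub>k x\<close> returns to \<open>x\<close>, then the flow at the times \<open>n\<^sub>k\<close> keeps the base point and returns to
  \<open>g s x\<close>, by continuity of \<open>g s\<close>.

  Conversely, let the flow return along times \<open>t\<^sub>k\<close>. Convergence on the circle says that \<open>t\<^sub>k\<close> differs
  from the nearest integer \<open>n\<^sub>k\<close> by some \<open>\<delta>\<^sub>k\<close> that tends to 0. Write \<open>y\<^sub>k = g 1 ^ n\<^sub>k x\<close>. Then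
  \<open>g (s + \<delta>\<^sub>k) y\<^sub>k\<close> tends to \<open>g s x\<close>, and so does \<open>g (s + \<delta>\<^sub>k) x\<close>; hence \<open>g (s + \<delta>\<^sub>k) (y\<^sub>k - x)\<close> tends to
  0. The operators \<open>g r\<close> with \<open>r\<close> near \<open>s\<close> are bounded below by a common constant
  (\<open>fundamental_solution_locally_bounded_below\<close>), so \<open>y\<^sub>k\<close> tends to \<open>x\<close>. The common constant is what
  replaces joint continuity of \<open>(r, w) \<mapsto> inv (g r) w\<close>.
\<close>

lemma min_abs_eq_dist_round:
  fixes u :: real
  assumes "\<bar>u\<bar> < 1"
  shows "min \<bar>u\<bar> (1 - \<bar>u\<bar>) = \<bar>u - of_int (round u)\<bar>"
proof -
  consider "u < - 1 / 2" | "- 1 / 2 \<le> u" "u < 1 / 2" | "1 / 2 \<le> u" by linarith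
  then show ?thesis
  proof cases
    case 1
    then have "round u = - 1" using assms unfolding round_def floor_eq_iff by auto
    with 1 assms show ?thesis by auto
  next
    case 2
    then have "round u = 0" unfolding round_def floor_eq_iff by auto
    with 2 show ?thesis by auto
  next
    case 3
    then have "round u = 1" using assms unfolding round_def floor_eq_iff by auto
    with 3 assms show ?thesis by auto
  qed
qed

text \<open>The circle part of the metric is the distance of the difference of two representatives to the
  nearest integer. This form no longer mentions the representatives in \<open>[0,1)\<close>.\<close>

lemma circle_prod_dist_circle_of_add:
  "circle_prod_dist (circle_of (s + t), x) (circle_of s, y) = \<bar>t - of_int (round t)\<bar> + dist x y"
proof -
  define u where "u = frac (s + t) - frac s"
  have u: "\<bar>u\<bar> < 1"
    using frac_lt_1[of "s + t"] frac_lt_1[of s] frac_ge_0[of "s + t"] frac_ge_0[of s]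
    unfolding u_def by linarith
  define k where "k = \<lfloor>s + t\<rfloor> - \<lfloor>s\<rfloor>"
  have t: "t = u + of_int k" by (simp add: u_def k_def frac_def)
  have "round t = round u + k"
    using floor_add_int[of "u + 1 / 2" k] unfolding t round_def by (simp only: add_ac)
  then have "t - of_int (round t) = u - of_int (round u)" using t by simp
  with u show ?thesis
    by (simp add: circle_prod_dist_def min_abs_eq_dist_round flip: u_def)
qed

lemma limitin_circle_prod_iff:
  "limitin (Metric_space.mtopology UNIV circle_prod_dist)
     (\<lambda>k. (circle_of (s + t k), w k)) (circle_of s, z) sequentially \<longleftrightarrow>
   (\<lambda>k. t k - of_int (round (t k))) \<longlonglongrightarrow> 0 \<and> w \<longlonglongrightarrow> z"
  (is "?L \<longleftrightarrow> ?R")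
proof -
  have "?L \<longleftrightarrow> (\<lambda>k. \<bar>t k - of_int (round (t k))\<bar> + dist (w k) z) \<longlonglongrightarrow> 0"
    by (simp add: Metric_space.limitin_metric_dist_null[OF Metric_space_circle_prod_dist]
        circle_prod_dist_circle_of_add)
  also have "\<dots> \<longleftrightarrow> ?R"
  proof
    assume sum: "(\<lambda>k. \<bar>t k - of_int (round (t k))\<bar> + dist (w k) z) \<longlonglongrightarrow> 0"
    have "(\<lambda>k. t k - of_int (round (t k))) \<longlonglongrightarrow> 0"
      by (rule Lim_null_comparison[OF _ sum]) simp
    moreover have "(\<lambda>k. dist (w k) z) \<longlonglongrightarrow> 0"
      by (rule Lim_null_comparison[OF _ sum]) simp
    ultimately show ?R by (simp add: tendsto_dist_iff[of w])
  next
    assume R: ?R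
    then have "(\<lambda>k. \<bar>t k - of_int (round (t k))\<bar>) \<longlonglongrightarrow> 0" by (simp add: tendsto_rabs_zero_iff)
    moreover have "(\<lambda>k. dist (w k) z) \<longlonglongrightarrow> 0" using R by (simp add: tendsto_dist_iff[of w])
    ultimately show "(\<lambda>k. \<bar>t k - of_int (round (t k))\<bar> + dist (w k) z) \<longlonglongrightarrow> 0"
      by (rule tendsto_add_zero)
  qed
  finally show ?thesis .
qed

lemma limitin_dist_iff:
  "limitin (Metric_space.mtopology UNIV dist) f l F \<longleftrightarrow> (f \<longlongrightarrow> l) F"
  by (simp flip: mtopology_is_euclidean)

context
  fixes X g :: "real \<Rightarrow> 'a::banach \<Rightarrow>\<^sub>L 'a"
  assumes cont: "continuous_on UNIV X" and per: "\<And>t. X (t + 1) = X t"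
    and fund: "fundamental_solution X g"
begin

text \<open>The time-one map is invertible, so the Floquet identity extends to negative times.\<close>

lemma fundamental_solution_add_int:
  "blinfun_apply (g (s + of_int n)) x = blinfun_apply (g s) (discrete_flow (g 1) n x)"
proof -
  have nat: "blinfun_apply (g (s + real m)) x = blinfun_apply (g s) ((blinfun_apply (g 1) ^^ m) x)"
    for s m x
  proof (induction m arbitrary: x)
    case (Suc m)
    have "blinfun_apply (g (s + real (Suc m))) x = blinfun_apply (g (s + real m)) (blinfun_apply (g 1) x)"
      using fundamental_solution_add_1[OF cont per fund, of "s + real m"]
      by (simp add: add_ac)
    with Suc show ?case by (simp add: funpow_swap1)
  qed simp
  show ?thesis
  proof (cases "0 \<le> n")
    case True
    then show ?thesis using nat[of s "nat n" x] by (simp add: discrete_flow_def)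
  next
    case False
    define m where "m = nat (- n)"
    have n: "of_int n = - real m" using False by (simp add: m_def)
    have bij: "bij (blinfun_apply (g 1))" by (rule fundamental_solution_bij[OF cont per fund])
    have "(blinfun_apply (g 1) ^^ m) ((inv (blinfun_apply (g 1)) ^^ m) x) = x"
      using bij by (metis inv_fn bij_fn bij_inv_eq_iff)
    then show ?thesis
      using nat[of "s - real m" m "(inv (blinfun_apply (g 1)) ^^ m) x"] False
      by (simp add: discrete_flow_def n flip: m_def)
  qed
qed

text \<open>Over a short time a solution keeps at least two thirds of its norm. Chaining short times
  from 0 to \<open>s\<close> gives a lower bound for \<open>g s\<close>; one more short time carries it to all
  \<open>r\<close> near \<open>s\<close>.\<close>

lemma fundamental_solution_locally_bounded_below:
  obtains c \<delta> where "0 < c" "0 < \<delta>"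
    "\<And>r y. \<bar>r - s\<bar> \<le> \<delta> \<Longrightarrow> c * norm y \<le> norm (blinfun_apply (g r) y)"
proof -
  obtain \<delta> where \<delta>: "0 < \<delta>"
    "\<And>h s t. (\<And>t. (h has_vector_derivative blinfun_apply (X t) (h t)) (at t)) \<Longrightarrow>
       \<bar>t - s\<bar> \<le> \<delta> \<Longrightarrow> norm (h t - h s :: 'a) \<le> norm (h s) / 3"
    using linear_ode_bound_step[OF cont per fund] by blast
  have short: "2 / 3 * norm (blinfun_apply (g a) y) \<le> norm (blinfun_apply (g b) y)"
    if "\<bar>b - a\<bar> \<le> \<delta>" for a b y
  proof -
    have "norm (blinfun_apply (g b) y - blinfun_apply (g a) y) \<le> norm (blinfun_apply (g a) y) / 3"
      by (rule \<delta>(2)[OF fundamental_solution_vector_derivative[OF cont per fund] that])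
    then show ?thesis
      using norm_triangle_sub[of "blinfun_apply (g a) y" "blinfun_apply (g b) y"]
      by (simp add: norm_minus_commute)
  qed
  have step: "2 / 3 * c * norm y \<le> norm (blinfun_apply (g b) y)"
    if "\<forall>y. c * norm y \<le> norm (blinfun_apply (g a) y)" "\<bar>b - a\<bar> \<le> \<delta>" for a b c y
    using that(1)[rule_format, of y] short[OF that(2), of y] by linarith
  have "\<exists>c>0. \<forall>y. c * norm y \<le> norm (blinfun_apply (g s) y)"
  proof (rule real_local_propagation[where \<delta> = \<delta> and a = 0])
    show "\<exists>c>0. \<forall>y. c * norm y \<le> norm (blinfun_apply (g 0) y)"
      using fund by (auto simp: fundamental_solution_def intro!: exI[of _ 1])
  next
    fix a b
    assume "\<exists>c>0. \<forall>y. c * norm y \<le> norm (blinfun_apply (g a) y)" and ab: "\<bar>b - a\<bar> \<le> \<delta>"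
    then obtain c where "0 < c" "\<forall>y. c * norm y \<le> norm (blinfun_apply (g a) y)" by blast
    with step[OF _ ab] show "\<exists>c>0. \<forall>y. c * norm y \<le> norm (blinfun_apply (g b) y)"
      by (intro exI[of _ "2 / 3 * c"]) auto
  qed (rule \<delta>(1))
  then obtain c where "0 < c" "\<forall>y. c * norm y \<le> norm (blinfun_apply (g s) y)" by blast
  with step \<delta>(1) show thesis by (intro that[of "2 / 3 * c" \<delta>]) auto
qed

lemma tendsto_of_fundamental_solution_tendsto:
  assumes r: "r \<longlonglongrightarrow> s" and gy: "(\<lambda>k. blinfun_apply (g (r k)) (y k)) \<longlonglongrightarrow> blinfun_apply (g s) x"
  shows "y \<longlonglongrightarrow> x"
proof -
  obtain c \<delta> where c: "0 < c" "0 < \<delta>"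
    "\<And>r y. \<bar>r - s\<bar> \<le> \<delta> \<Longrightarrow> c * norm y \<le> norm (blinfun_apply (g r) y)"
    using fundamental_solution_locally_bounded_below by blast
  have "isCont (\<lambda>t. blinfun_apply (g t) x) s"
    by (rule has_vector_derivative_continuous[OF fundamental_solution_vector_derivative[OF cont per fund]])
  then have "(\<lambda>k. blinfun_apply (g (r k)) x) \<longlonglongrightarrow> blinfun_apply (g s) x"
    using r by (rule isCont_tendsto_compose)
  from tendsto_diff[OF gy this]
  have "(\<lambda>k. blinfun_apply (g (r k)) (y k - x)) \<longlonglongrightarrow> 0" by (simp add: blinfun.diff_right)
  then have lim: "(\<lambda>k. norm (blinfun_apply (g (r k)) (y k - x)) / c) \<longlonglongrightarrow> 0"
    by (intro tendsto_divide_zero tendsto_norm_zero)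
  have "\<forall>\<^sub>F k in sequentially. \<bar>r k - s\<bar> < \<delta>"
    using tendstoD[OF r c(2)] by (simp add: dist_real_def)
  then have "\<forall>\<^sub>F k in sequentially. norm (y k - x) \<le> norm (blinfun_apply (g (r k)) (y k - x)) / c"
  proof eventually_elim
    case (elim k)
    with c(3)[of "r k" "y k - x"] c(1) show ?case by (simp add: pos_le_divide_eq mult.commute)
  qed
  from Lim_null_comparison[OF this lim] show ?thesis by (rule LIM_zero_cancel)
qed

lemma recurrent_skew_product_iff:
  "(circle_of s, blinfun_apply (g s) x) \<in> recurrent_set circle_prod_dist (skew_product_flow g)
     \<longleftrightarrow> x \<in> recurrent_set dist (discrete_flow (g 1))"
    (is "?L \<longleftrightarrow> ?R")
proof -
  have flow: "skew_product_flow g t (circle_of s, blinfun_apply (g s) x)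
      = (circle_of (s + t), blinfun_apply (g (s + t)) x)" for t
    using skew_product_flow_circle_of[OF cont per fund] fundamental_solution_bij[OF cont per fund, of s]
    by (simp add: bij_is_inj add.commute)
  have L: "?L \<longleftrightarrow> (\<exists>t. filterlim t at_top sequentially \<and> (\<lambda>k. t k - of_int (round (t k))) \<longlonglongrightarrow> 0 \<and>
      (\<lambda>k. blinfun_apply (g (s + t k)) x) \<longlonglongrightarrow> blinfun_apply (g s) x)"
    by (simp add: recurrent_set_def omega_limit_def flow limitin_circle_prod_iff)
  have R: "?R \<longleftrightarrow> (\<exists>n. filterlim n at_top sequentially \<and> (\<lambda>k. discrete_flow (g 1) (n k) x) \<longlonglongrightarrow> x)"
    by (simp add: recurrent_set_def omega_limit_def limitin_dist_iff)
  show ?thesis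
  proof
    assume ?R
    then obtain n where n: "filterlim n at_top sequentially" "(\<lambda>k. discrete_flow (g 1) (n k) x) \<longlonglongrightarrow> x"
      unfolding R by blast
    have "filterlim (\<lambda>k. real_of_int (n k)) at_top sequentially"
      using n(1) by (rule filterlim_compose[OF filterlim_real_of_int_at_top])
    moreover have "(\<lambda>k. blinfun_apply (g (s + of_int (n k))) x) \<longlonglongrightarrow> blinfun_apply (g s) x"
      unfolding fundamental_solution_add_int by (intro blinfun.tendsto tendsto_const n(2))
    ultimately show ?L unfolding L by (intro exI[of _ "\<lambda>k. of_int (n k)"]) simp
  next
    assume ?L
    then obtain t where t: "filterlim t at_top sequentially"
      and \<delta>: "(\<lambda>k. t k - of_int (round (t k))) \<longlonglongrightarrow> 0"
      and ret: "(\<lambda>k. blinfun_apply (g (s + t k)) x) \<longlonglongrightarrow> blinfun_apply (g s) x"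
      unfolding L by blast
    define n where "n k = round (t k)" for k
    define r where "r k = s + (t k - of_int (n k))" for k
    have "filterlim n at_top sequentially"
      unfolding filterlim_at_top
    proof
      fix Z :: int
      have "\<forall>\<^sub>F k in sequentially. of_int Z \<le> t k"
        using t unfolding filterlim_at_top by blast
      then show "\<forall>\<^sub>F k in sequentially. Z \<le> n k"
      proof eventually_elim
        case (elim k)
        then show ?case using round_mono[of "of_int Z" "t k"] by (simp add: n_def)
      qed
    qed
    moreover have "(\<lambda>k. discrete_flow (g 1) (n k) x) \<longlonglongrightarrow> x"
    proof (rule tendsto_of_fundamental_solution_tendsto)
      show "r \<longlonglongrightarrow> s"
        using tendsto_add[OF tendsto_const \<delta>, of s] by (simp add: r_def[abs_def] n_def)
      have "blinfun_apply (g (r k)) (discrete_flow (g 1) (n k) x) = blinfun_apply (g (s + t k)) x" for k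
        by (simp add: r_def flip: fundamental_solution_add_int)
      with ret show "(\<lambda>k. blinfun_apply (g (r k)) (discrete_flow (g 1) (n k) x)) \<longlonglongrightarrow> blinfun_apply (g s) x"
        by simp
    qed
    ultimately show ?R unfolding R by blast
  qed
qed

end

theorem proposition3p1:
  fixes X g :: "real \<Rightarrow> 'a::banach \<Rightarrow>\<^sub>L 'a"
  assumes "continuous_on UNIV X"
    and "\<And>t. X (t + 1) = X t"
    and "fundamental_solution X g"
  shows "recurrent_set circle_prod_dist (skew_product_flow g) =
         circle_twisted_prod g (recurrent_set dist (discrete_flow (g 1)))"
proof (rule set_eqI)
  fix p :: "circle \<times> 'a"
  note iff = recurrent_skew_product_iff[OF assms]
  obtain c y where cy: "p = (c, y)" by (cases p)
  have "surj (blinfun_apply (g (circle_frac c)))"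
    by (rule bij_is_surj[OF fundamental_solution_bij[OF assms]])
  then obtain x where "y = blinfun_apply (g (circle_frac c)) x" by (rule surjE)
  then obtain s where p: "p = (circle_of s, blinfun_apply (g s) x)"
    by (simp add: cy that[of "circle_frac c"])
  show "p \<in> recurrent_set circle_prod_dist (skew_product_flow g) \<longleftrightarrow>
      p \<in> circle_twisted_prod g (recurrent_set dist (discrete_flow (g 1)))"
    (is "p \<in> ?R \<longleftrightarrow> p \<in> ?T")
  proof
    assume "p \<in> ?R"
    then show "p \<in> ?T" unfolding p iff circle_twisted_prod_def by blast
  next
    assume "p \<in> ?T"
    then obtain r y where "p = (circle_of r, blinfun_apply (g r) y)"
      "y \<in> recurrent_set dist (discrete_flow (g 1))"
      unfolding circle_twisted_prod_def by blast
    then show "p \<in> ?R" by (simp add: iff)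
  qed
qed

end
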